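(* Let $\mathcal{A}$ be a Banach algebra such that $\mathrm{rad}(\mathcal{A})=\mathrm{rann}(\mathcal{A})$ and $\mathcal{A}/\mathrm{rad}(\mathcal{A})$ is commutative, and suppose $\mathcal{A}$ has a right identity. Let $(\delta,d)$ be a generalized derivation of $\mathcal{A}$ and $k\in\mathbb{N}$. Then: (i) if $\delta$ is $k$-skew centralizing, there exists $z\in Z(\mathcal{A})$ such that $\delta=R_z$; (ii) if $\delta$ is $k$-skew commuting, then $\delta=0$.
   Context: $\mathrm{rad}(\mathcal{A})$ is the Jacobson radical and $\mathrm{rann}(\mathcal{A})=\{c\in\mathcal{A}: ac=0\ \forall a\in\mathcal{A}\}$. A derivation is a linear map $d$ with $d(ab)=d(a)b+ad(b)$; a generalized derivation $(\delta,d)$ consists of a derivation $d$ and linear $\delta$ with $\delta(ab)=a\delta(b)+d(a)b$. $Z(\mathcal{A})$ is the center. Write $\langle a,b\rangle=ab+ba$. A map $T$ is $k$-skew centralizing (resp. $k$-skew commuting) if $\langle T(a),a^k\rangle\in Z(\mathcal{A})$ (resp. $=0$) for all $a\in\mathcal{A}$. $R_z(a)=az$. *)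

theory Defs
  imports Complex_Main
begin

class cbanach_algebra = real_normed_algebra + banach +
  fixes scaleC :: "complex \<Rightarrow> 'a \<Rightarrow> 'a"
  assumes scaleC_of_real: "scaleC (complex_of_real r) x = scaleR r x"
    and scaleC_add_right: "scaleC c (x + y) = scaleC c x + scaleC c y"
    and scaleC_add_left: "scaleC (c + e) x = scaleC c x + scaleC e x"
    and scaleC_scaleC: "scaleC c (scaleC e x) = scaleC (c * e) x"
    and norm_scaleC: "norm (scaleC c x) = cmod c * norm x"
    and mult_scaleC_left: "scaleC c x * y = scaleC c (x * y)"
    and mult_scaleC_right: "x * scaleC c y = scaleC c (x * y)"

definition clinear_map :: "('a::cbanach_algebra \<Rightarrow> 'a) \<Rightarrow> bool" where
  "clinear_map f \<longleftrightarrow> (\<forall>x y. f (x + y) = f x + f y) \<and> (\<forall>c x. f (scaleC c x) = scaleC c (f x))"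

definition quasi_invertible :: "'a::ring \<Rightarrow> bool" where
  "quasi_invertible a \<longleftrightarrow> (\<exists>b. a + b - a * b = 0 \<and> a + b - b * a = 0)"

definition jacobson_rad :: "'a::ring set" where
  "jacobson_rad = {a. \<forall>b. quasi_invertible (b * a)}"

definition right_annihilator :: "'a::ring set" where
  "right_annihilator = {c. \<forall>a. a * c = 0}"

definition center :: "'a::ring set" where
  "center = {z. \<forall>a. z * a = a * z}"

definition is_derivation :: "('a::cbanach_algebra \<Rightarrow> 'a) \<Rightarrow> bool" where
  "is_derivation d \<longleftrightarrow> clinear_map d \<and> (\<forall>a b. d (a * b) = d a * b + a * d b)"

definition is_gen_derivation :: "('a::cbanach_algebra \<Rightarrow> 'a) \<Rightarrow> ('a \<Rightarrow> 'a) \<Rightarrow> bool" where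
  "is_gen_derivation \<delta> d \<longleftrightarrow> is_derivation d \<and> clinear_map \<delta> \<and>
     (\<forall>a b. \<delta> (a * b) = a * \<delta> b + d a * b)"

text \<open>Positive powers in a non-unital algebra: apow a k = a^k for k \<ge> 1 (apow a 0 = a, unused).\<close>

fun apow :: "'a::ring \<Rightarrow> nat \<Rightarrow> 'a" where
  "apow a 0 = a"
| "apow a (Suc 0) = a"
| "apow a (Suc (Suc n)) = a * apow a (Suc n)"

definition skew_prod :: "'a::ring \<Rightarrow> 'a \<Rightarrow> 'a" where
  "skew_prod a b = a * b + b * a"

definition k_skew_centralizing :: "nat \<Rightarrow> ('a::ring \<Rightarrow> 'a) \<Rightarrow> bool" where
  "k_skew_centralizing k T \<longleftrightarrow> (\<forall>a. skew_prod (T a) (apow a k) \<in> center)"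

definition k_skew_commuting :: "nat \<Rightarrow> ('a::ring \<Rightarrow> 'a) \<Rightarrow> bool" where
  "k_skew_commuting k T \<longleftrightarrow> (\<forall>a. skew_prod (T a) (apow a k) = 0)"

end

theory Submission
  imports Defs "HOL-Analysis.Analysis"
begin

text \<open>
  Let \<open>e\<close> be a right identity. The corner \<open>e A\<close> is a commutative semisimple Banach algebra with
  unit \<open>e\<close>, and \<open>D x = e * d x\<close> is a derivation of it. That \<open>D = 0\<close> is the theorem of Johnson and
  of Singer and Wermer, proved here without characters. A gliding hump gives, if the separating
  space \<open>S\<close> of \<open>D\<close> is nonzero, some \<open>b\<close> with \<open>b S \<noteq> 0\<close> such that each \<open>c b S\<close> is zero or dense in
  \<open>b S\<close>. By semisimplicity \<open>b S\<close> contains some \<open>q\<close> with \<open>e - q\<close> not invertible; density of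
  \<open>(e - q) b S\<close> would make \<open>e - q\<close> invertible, so \<open>(e - q) b S = 0\<close>, and \<open>q\<close> is the unit of a
  field, which is \<open>\<complex> q\<close> by Gelfand and Mazur. Hence \<open>q D = 0\<close>, which contradicts \<open>q \<in> S\<close>. So \<open>D\<close>
  is bounded, and then \<open>D a\<close> is quasinilpotent, since the \<open>n\<close>-fold commutator of multiplication
  by \<open>a\<close> with \<open>D ^ n\<close> is, up to sign, multiplication by \<open>n! (D a) ^ n\<close>.

  Therefore \<open>d\<close> takes values in the right annihilator. If \<open>\<delta>\<close> is \<open>k\<close>-skew centralizing, comparing
  \<open>\<langle>\<delta> a, a ^ k\<rangle>\<close> with its product by \<open>e\<close> gives \<open>d a * a ^ k = 0\<close>; replacing \<open>a\<close> by \<open>e + t a\<close> and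
  letting \<open>t\<close> tend to \<open>0\<close> yields \<open>d = 0\<close>.
\<close>

section \<open>The separating space\<close>

text \<open>Limits of \<open>T x\<close> along null sequences in \<open>x\<close>, that is, the
  fibre over \<open>0\<close> of the closure of the graph.\<close>

definition separating_space :: "('a::real_normed_vector \<Rightarrow> 'b::real_normed_vector) \<Rightarrow> 'b set" where
  "separating_space T = {y. \<forall>\<epsilon>>0. \<exists>x. norm x < \<epsilon> \<and> norm (T x - y) < \<epsilon>}"

lemma separating_spaceD:
  "y \<in> separating_space T \<Longrightarrow> \<epsilon> > 0 \<Longrightarrow> \<exists>x. norm x < \<epsilon> \<and> norm (T x - y) < \<epsilon>"
  by (auto simp: separating_space_def)

section \<open>The separating space as a linear subspace\<close>

lemma separating_space_0:
  assumes "linear T"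
  shows "0 \<in> separating_space T"
  unfolding separating_space_def
  by (auto intro!: exI[of _ 0] simp: linear_0[OF assms])

lemma separating_space_add:
  assumes T: "linear T" and "y \<in> separating_space T" "z \<in> separating_space T"
  shows "y + z \<in> separating_space T"
  unfolding separating_space_def
proof (intro CollectI allI impI)
  fix \<epsilon> :: real assume "\<epsilon> > 0"
  then obtain u v where u: "norm u < \<epsilon>/2" "norm (T u - y) < \<epsilon>/2"
    and v: "norm v < \<epsilon>/2" "norm (T v - z) < \<epsilon>/2"
    using assms(2,3) separating_spaceD[of _ T "\<epsilon>/2"] by (meson half_gt_zero)
  have "norm (T (u + v) - (y + z)) \<le> norm (T u - y) + norm (T v - z)"
    using norm_triangle_ineq[of "T u - y" "T v - z"] by (simp add: linear_add[OF T] algebra_simps)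
  moreover have "norm (u + v) \<le> norm u + norm v" by (rule norm_triangle_ineq)
  ultimately show "\<exists>x. norm x < \<epsilon> \<and> norm (T x - (y + z)) < \<epsilon>"
    using u v by (intro exI[of _ "u + v"]) linarith
qed

lemma separating_space_scaleR:
  assumes T: "linear T" and y: "y \<in> separating_space T"
  shows "r *\<^sub>R y \<in> separating_space T"
  unfolding separating_space_def
proof (intro CollectI allI impI)
  fix \<epsilon> :: real assume e: "\<epsilon> > 0"
  obtain u where u: "norm u < \<epsilon> / (\<bar>r\<bar> + 1)" "norm (T u - y) < \<epsilon> / (\<bar>r\<bar> + 1)"
    using separating_spaceD[OF y, of "\<epsilon> / (\<bar>r\<bar> + 1)"] e by auto
  have *: "\<bar>r\<bar> * t < \<epsilon>" if "t < \<epsilon> / (\<bar>r\<bar> + 1)" "t \<ge> 0" for t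
  proof -
    have "\<bar>r\<bar> * t \<le> (\<bar>r\<bar> + 1) * t" using that by (intro mult_right_mono) auto
    also have "\<dots> < \<epsilon>" using that by (simp add: field_simps)
    finally show ?thesis .
  qed
  have "T (r *\<^sub>R u) - r *\<^sub>R y = r *\<^sub>R (T u - y)" by (simp add: linear_scale[OF T] algebra_simps)
  then show "\<exists>x. norm x < \<epsilon> \<and> norm (T x - r *\<^sub>R y) < \<epsilon>"
    using *[OF u(1)] *[OF u(2)] by (intro exI[of _ "r *\<^sub>R u"]) simp
qed

lemma separating_space_sum:
  assumes "linear T" and "\<And>i::nat. s i \<in> separating_space T"
  shows "(\<Sum>i<n. s i) \<in> separating_space T"
  by (induction n) (auto intro: separating_space_0 separating_space_add assms)

text \<open>Otherwise the closures would be nowhere dense and, by Baire, their union could not be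
  the whole space.\<close>

lemma Baire_closure_cover:
  fixes F :: "nat \<Rightarrow> 'a::complete_space set"
  assumes "(\<Union>n. F n) = UNIV"
  obtains n x r where "r > 0" "ball x r \<subseteq> closure (F n)"
proof -
  have "\<exists>n. interior (closure (F n)) \<noteq> {}"
  proof (rule ccontr)
    assume "\<not> ?thesis"
    then have "euclidean interior_of (\<Union> (range (\<lambda>n. closure (F n)))) = {}"
      by (intro Baire_category_alt) (auto intro: completely_metrizable_space_euclidean)
    moreover have "(\<Union> (range (\<lambda>n. closure (F n)))) = UNIV"
      using assms closure_subset by blast
    ultimately show False by simp
  qed
  then obtain n x where "x \<in> interior (closure (F n))" by blast
  then obtain r where "r > 0" "ball x r \<subseteq> closure (F n)"
    by (meson mem_interior)
  then show ?thesis by (rule that)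
qed

text \<open>The closed graph theorem for the map that \<open>T\<close> induces into the quotient by its
  separating space.\<close>

lemma dist_separating_space_bounded:
  fixes T :: "'a::banach \<Rightarrow> 'b::banach"
  assumes T: "linear T"
  obtains M where "M \<ge> 0" "\<And>y. \<exists>s\<in>separating_space T. norm (T y - s) \<le> M * norm y"
proof -
  let ?S = "separating_space T"
  define F where "F m = {y. \<exists>s\<in>?S. norm (T y - s) \<le> real m}" for m :: nat
  have "(\<Union>m. F m) = UNIV"
  proof -
    have "y \<in> F (nat \<lceil>norm (T y)\<rceil>)" for y
      unfolding F_def by (auto intro!: bexI[of _ 0] separating_space_0[OF T] simp: real_nat_ceiling_ge)
    then show ?thesis by blast
  qed
  then obtain m x0 r where r: "r > 0" and ball: "ball x0 r \<subseteq> closure (F m)"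
    by (rule Baire_closure_cover)
  define C where "C = 4 * real m / r"
  have C: "C \<ge> 0" using r by (simp add: C_def)
  \<comment> \<open>\<open>y\<close> is the difference of \<open>x0 + y\<close> and
    \<open>x0\<close>, both in the ball; approximating each from \<open>F m\<close> doubles the
    bound.\<close>
  have step0: "\<exists>w s. s \<in> ?S \<and> norm (T w - s) \<le> 2 * real m \<and> norm (y - w) < \<epsilon>"
    if y: "norm y < r" and \<epsilon>: "\<epsilon> > 0" for y \<epsilon>
  proof -
    have "x0 + y \<in> closure (F m)" "x0 \<in> closure (F m)"
      using ball r y by (auto simp: dist_norm subset_iff)
    then obtain u v where u: "u \<in> F m" "dist u (x0 + y) < \<epsilon>/2" and v: "v \<in> F m" "dist v x0 < \<epsilon>/2"
      using \<epsilon> unfolding closure_approachable by (meson half_gt_zero)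
    obtain s s' where s: "s \<in> ?S" "norm (T u - s) \<le> m" and s': "s' \<in> ?S" "norm (T v - s') \<le> m"
      using u v by (auto simp: F_def)
    have "s - s' \<in> ?S"
      using separating_space_add[OF T s(1) separating_space_scaleR[OF T s'(1), of "-1"]] by simp
    moreover have "norm (T (u - v) - (s - s')) \<le> 2 * real m"
      using norm_triangle_ineq4[of "T u - s" "T v - s'"] s s'
      by (simp add: linear_diff[OF T] algebra_simps)
    moreover have "norm (y - (u - v)) < \<epsilon>"
      using norm_triangle_ineq4[of "v - x0" "u - (x0 + y)"] u v by (simp add: dist_norm algebra_simps)
    ultimately show ?thesis by blast
  qed
  \<comment> \<open>The error is halved so that the approximation can be iterated on the
    remainder.\<close>
  have step: "\<exists>w s. s \<in> ?S \<and> norm (T w - s) \<le> C * norm y \<and> norm (y - w) \<le> norm y / 2" for y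
  proof (cases "y = 0")
    case True
    then show ?thesis
      by (intro exI[of _ 0]) (auto simp: linear_0[OF T] separating_space_0[OF T])
  next
    case False
    define k where "k = r / (2 * norm y)"
    have k: "k > 0" using False r by (simp add: k_def)
    have "norm (k *\<^sub>R y) < r" using False r k by (simp add: k_def)
    then obtain w s where ws: "s \<in> ?S" "norm (T w - s) \<le> 2 * real m" "norm (k *\<^sub>R y - w) < k * (norm y / 2)"
      using step0[of "k *\<^sub>R y" "k * (norm y / 2)"] False k by auto
    have "norm (T ((1/k) *\<^sub>R w) - (1/k) *\<^sub>R s) = (1/k) * norm (T w - s)"
      using k by (simp add: linear_scale[OF T] flip: scaleR_diff_right)
    also have "\<dots> \<le> (1/k) * (2 * real m)" using k ws by (intro mult_left_mono) auto
    also have "\<dots> = C * norm y" using r False by (simp add: k_def C_def field_simps)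
    finally have 1: "norm (T ((1/k) *\<^sub>R w) - (1/k) *\<^sub>R s) \<le> C * norm y" .
    have "y - (1/k) *\<^sub>R w = (1/k) *\<^sub>R (k *\<^sub>R y - w)" using k by (simp add: algebra_simps)
    then have "norm (y - (1/k) *\<^sub>R w) = norm (k *\<^sub>R y - w) / k" using k by simp
    also have "\<dots> \<le> norm y / 2" using ws k by (simp add: field_simps)
    finally show ?thesis using 1 separating_space_scaleR[OF T ws(1)] by blast
  qed
  then obtain w s where s: "\<And>y. s y \<in> ?S" and t: "\<And>y. norm (T (w y) - s y) \<le> C * norm y"
    and w: "\<And>y. norm (y - w y) \<le> norm y / 2" by metis
  have "\<exists>s\<in>?S. norm (T y - s) \<le> 2 * C * norm y" for y
  proof -
    \<comment> \<open>\<open>z n\<close> is the remainder of \<open>y\<close> after \<open>n\<close>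
      approximations; \<open>t' n\<close> below is the controlled part of the image of the next
      one.\<close>
    define z where "z = rec_nat y (\<lambda>_ u. u - w u)"
    have z0: "z 0 = y" and zS: "z (Suc n) = z n - w (z n)" for n by (auto simp: z_def)
    have zn: "norm (z n) \<le> norm y * (1/2)^n" for n
    proof (induction n)
      case (Suc n)
      then show ?case using w[of "z n"] by (simp add: zS)
    qed (simp add: z0)
    define t' where "t' n = T (w (z n)) - s (z n)" for n
    have t': "norm (t' n) \<le> (C * norm y) * (1/2)^n" for n
      using order_trans[OF t[of "z n"] mult_left_mono[OF zn[of n] C]] by (simp add: t'_def mult.assoc)
    have sg: "(\<lambda>n. (C * norm y) * (1/2)^n) sums (2 * C * norm y)"
      using sums_mult[OF geometric_sums[of "1/2::real"], of "C * norm y"] by (simp add: mult_ac)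
    have sum: "summable t'" by (rule summable_comparison_test'[OF sums_summable[OF sg]]) (use t' in auto)
    have nt: "norm (suminf t') \<le> 2 * C * norm y"
      using norm_suminf_le[OF t' sums_summable[OF sg]] sums_unique[OF sg] by simp
    have dec: "T y = T (z n) + (\<Sum>i<n. t' i) + (\<Sum>i<n. s (z i))" for n
      by (induction n) (auto simp: z0 zS t'_def linear_diff[OF T] algebra_simps)
    \<comment> \<open>The sums of the \<open>s (z i)\<close> may diverge, but each lies in the
      separating space, so a small \<open>v\<close> with \<open>T v\<close> close to it
      compensates.\<close>
    have "T y - suminf t' \<in> ?S"
      unfolding separating_space_def
    proof (intro CollectI allI impI)
      fix \<epsilon> :: real assume e: "\<epsilon> > 0"
      have "(\<lambda>n. norm y * (1/2)^n) \<longlonglongrightarrow> norm y * 0"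
        by (intro tendsto_intros LIMSEQ_power_zero) auto
      then have "\<forall>\<^sub>F n in sequentially. norm y * (1/2)^n < \<epsilon>/2"
        using e by (intro order_tendstoD(2)) auto
      moreover have "\<forall>\<^sub>F n in sequentially. dist (\<Sum>i<n. t' i) (suminf t') < \<epsilon>/2"
        using summable_LIMSEQ[OF sum] e by (intro tendstoD) auto
      ultimately have "\<forall>\<^sub>F n in sequentially. norm y * (1/2)^n < \<epsilon>/2 \<and> dist (\<Sum>i<n. t' i) (suminf t') < \<epsilon>/2"
        by (rule eventually_conj)
      then obtain n where n: "norm y * (1/2)^n < \<epsilon>/2" "dist (\<Sum>i<n. t' i) (suminf t') < \<epsilon>/2"
        by (auto simp: eventually_sequentially)
      have "(\<Sum>i<n. s (z i)) \<in> ?S" by (rule separating_space_sum[OF T s])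
      then obtain v where v: "norm v < \<epsilon>/2" "norm (T v - (\<Sum>i<n. s (z i))) < \<epsilon>/2"
        using separating_spaceD e by (meson half_gt_zero)
      have "norm (z n + v) < \<epsilon>"
        using zn[of n] n v norm_triangle_ineq[of "z n" v] by linarith
      moreover have eq: "T (z n + v) - (T y - suminf t') =
         (T v - (\<Sum>i<n. s (z i))) - ((\<Sum>i<n. t' i) - suminf t')"
        using dec[of n] by (simp add: linear_add[OF T])
      have "norm (T (z n + v) - (T y - suminf t')) < \<epsilon>"
        unfolding eq using v n norm_triangle_ineq4[of "T v - (\<Sum>i<n. s (z i))" "(\<Sum>i<n. t' i) - suminf t'"]
        unfolding dist_norm by linarith
      ultimately show "\<exists>x. norm x < \<epsilon> \<and> norm (T x - (T y - suminf t')) < \<epsilon>" by blast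
    qed
    moreover have "T y - (T y - suminf t') = suminf t'" by simp
    ultimately show ?thesis using nt by (intro bexI[of _ "T y - suminf t'"]) auto
  qed
  then show ?thesis using C by (intro that[of "2 * C"]) auto
qed

section \<open>Corners and the Gelfand--Mazur theorem\<close>

lemma scaleC_1 [simp]: "scaleC 1 (x::'a::cbanach_algebra) = x"
  using scaleC_of_real[of 1 x] by simp

lemma scaleC_0_left [simp]: "scaleC 0 (x::'a::cbanach_algebra) = 0"
  using scaleC_of_real[of 0 x] by simp

lemma scaleC_0_right [simp]: "scaleC c (0::'a::cbanach_algebra) = 0"
  using scaleC_add_right[of c 0 "0::'a"] by simp

lemma scaleC_minus_left: "scaleC (- c) (x::'a::cbanach_algebra) = - scaleC c x"
  using scaleC_add_left[of c "- c" x] by (simp add: add_eq_0_iff)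

lemma scaleC_minus_right: "scaleC c (- x::'a::cbanach_algebra) = - scaleC c x"
  using scaleC_add_right[of c x "- x"] by (simp add: add_eq_0_iff)

lemma scaleC_diff_left: "scaleC (b - c) (x::'a::cbanach_algebra) = scaleC b x - scaleC c x"
  using scaleC_add_left[of b "- c" x] by (simp add: scaleC_minus_left)

lemma scaleC_diff_right: "scaleC c (x - y::'a::cbanach_algebra) = scaleC c x - scaleC c y"
  using scaleC_add_right[of c x "- y"] by (simp add: scaleC_minus_right)

lemma scaleC_sum_left: "scaleC (sum f A) (x::'a::cbanach_algebra) = (\<Sum>i\<in>A. scaleC (f i) x)"
  by (induction A rule: infinite_finite_induct) (auto simp: scaleC_add_left)

text \<open>For idempotent \<open>q\<close> this is \<open>q A q\<close>, and it is
  \<open>q A\<close> when \<open>q\<close> is a right identity.\<close>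

definition corner :: "'a::ring \<Rightarrow> 'a set" where
  "corner q = {y. q * y = y \<and> y * q = y}"

lemma cornerD: "y \<in> corner q \<Longrightarrow> q * y = y" "y \<in> corner q \<Longrightarrow> y * q = y"
  by (auto simp: corner_def)

lemma corner_add: "x \<in> corner q \<Longrightarrow> y \<in> corner q \<Longrightarrow> x + y \<in> corner q"
  and corner_diff: "x \<in> corner q \<Longrightarrow> y \<in> corner q \<Longrightarrow> x - y \<in> corner q"
  and corner_mult: "x \<in> corner q \<Longrightarrow> y \<in> corner q \<Longrightarrow> x * y \<in> corner q"
  by (auto simp: corner_def algebra_simps mult.assoc) (metis mult.assoc)+

lemma corner_scaleC: "(x::'a::cbanach_algebra) \<in> corner q \<Longrightarrow> scaleC c x \<in> corner q"
  by (simp add: corner_def mult_scaleC_left mult_scaleC_right)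

lemma closed_corner: "closed (corner (q::'a::real_normed_algebra))"
proof -
  have "closed {y. q * y = y}" "closed {y. y * q = y}"
    by (rule closed_Collect_eq; intro continuous_intros)+
  then show ?thesis unfolding corner_def by (rule closed_Collect_conj)
qed

lemma corner_suminf:
  fixes f :: "nat \<Rightarrow> 'a::real_normed_algebra"
  assumes "summable f" "\<And>n. f n \<in> corner q"
  shows "suminf f \<in> corner q"
proof -
  have "q * suminf f = suminf f"
    by (simp only: suminf_mult[OF assms(1), symmetric] cornerD(1)[OF assms(2)])
  moreover have "suminf f * q = suminf f"
    by (simp only: suminf_mult2[OF assms(1)] cornerD(2)[OF assms(2)])
  ultimately show ?thesis by (simp add: corner_def)
qed

text \<open>Powers relative to the unit \<open>q\<close>: the zeroth power is \<open>q\<close>.\<close>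

definition upow :: "'a::ring \<Rightarrow> 'a \<Rightarrow> nat \<Rightarrow> 'a" where
  "upow q y n = (((*) y) ^^ n) q"

lemma upow_0 [simp]: "upow q y 0 = q"
  and upow_Suc: "upow q y (Suc n) = y * upow q y n"
  by (auto simp: upow_def)

lemma upow_corner: "q * q = q \<Longrightarrow> y \<in> corner q \<Longrightarrow> upow q y n \<in> corner q"
  by (induction n) (simp_all add: upow_Suc corner_mult, simp add: corner_def)

lemma upow_Suc2: "q * q = q \<Longrightarrow> y \<in> corner q \<Longrightarrow> upow q y (Suc n) = upow q y n * y"
proof (induction n)
  case (Suc n)
  then have "upow q y (Suc (Suc n)) = y * (upow q y n * y)"
    by (simp only: upow_Suc[of q y "Suc n"])
  then show ?case by (simp only: mult.assoc upow_Suc)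
qed (simp add: upow_Suc cornerD)

lemma norm_upow_le: "norm (upow q (y::'a::real_normed_algebra) n) \<le> norm q * norm y ^ n"
proof (induction n)
  case (Suc n)
  have "norm (upow q y (Suc n)) \<le> norm y * norm (upow q y n)"
    by (simp add: upow_Suc norm_mult_ineq)
  also have "\<dots> \<le> norm y * (norm q * norm y ^ n)" by (intro mult_left_mono Suc) auto
  finally show ?case by (simp add: mult_ac)
qed auto

lemma upow_scaleC: "upow q (scaleC c (x::'a::cbanach_algebra)) n = scaleC (c ^ n) (upow q x n)"
  by (induction n) (auto simp: upow_Suc mult_scaleC_left mult_scaleC_right scaleC_scaleC mult_ac)

text \<open>Summability of the powers, rather than \<open>norm y < 1\<close>, is assumed so that
  quasinilpotent elements of large norm are covered.\<close>

lemma neumann_series: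
  fixes y :: "'a::{real_normed_algebra,banach}"
  assumes q: "q * q = q" and y: "y \<in> corner q" and s: "summable (\<lambda>n. norm (upow q y n))"
  obtains u where "u \<in> corner q" "(q - y) * u = q"
proof
  let ?u = "\<Sum>n. upow q y n"
  have sm: "summable (upow q y)" by (rule summable_norm_cancel[OF s])
  show u: "?u \<in> corner q" by (intro corner_suminf sm upow_corner q y)
  have "y * ?u = (\<Sum>n. upow q y (Suc n))" unfolding upow_Suc by (intro suminf_mult[symmetric] sm)
  also have "\<dots> = ?u - q" using suminf_split_head[OF sm] by simp
  finally show "(q - y) * ?u = q" using u by (simp add: algebra_simps cornerD)
qed

lemma neumann_norm_less_1:
  fixes y :: "'a::{real_normed_algebra,banach}"
  assumes q: "q * q = q" and y: "y \<in> corner q" and n: "norm y < 1"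
  obtains u where "u \<in> corner q" "(q - y) * u = q"
proof (rule neumann_series[OF q y])
  show "summable (\<lambda>n. norm (upow q y n))"
    by (rule summable_comparison_test'[where g = "\<lambda>n. norm q * norm y ^ n"])
       (use n norm_upow_le in \<open>auto intro!: summable_mult\<close>)
qed

text \<open>Makes \<open>q - y ^ n\<close> times an inverse of \<open>q - y\<close> a polynomial in
  \<open>y\<close>, ready for averaging over roots of unity.\<close>

lemma upow_telescope:
  assumes q: "q * q = q" and y: "y \<in> corner q"
  shows "(\<Sum>j<n. upow q y j) * (q - y) = q - upow q y n"
proof (induction n)
  case (Suc n)
  have "upow q y n * (q - y) = upow q y n - upow q y (Suc n)"
    using upow_Suc2[OF q y, of n] upow_corner[OF q y, of n] by (simp add: right_diff_distrib cornerD)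
  then show ?case using Suc by (simp add: distrib_right)
qed (use y in \<open>simp add: cornerD\<close>)

text \<open>The \<open>j\<close>-th powers form a geometric progression whose ratio
  \<open>w \<noteq> 1\<close> satisfies \<open>w ^ n = 1\<close>.\<close>

lemma sum_powers_root_of_unity:
  fixes n j :: nat
  assumes "0 < j" "j < n"
  shows "(\<Sum>k<n. exp (2 * of_real pi * \<i> * of_nat k / of_nat n) ^ j) = 0"
proof -
  define w where "w = exp (2 * of_real pi * \<i> * of_nat j / of_nat n)"
  have "exp (2 * of_real pi * \<i> * of_nat k / of_nat n) ^ j = w ^ k" for k
    by (simp add: w_def mult_ac flip: exp_of_nat_mult)
  moreover have "w \<noteq> 1"
    using complex_root_unity_eq_1[of n j] assms unfolding w_def by (auto dest: dvd_imp_le)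
  moreover have "w ^ n = 1" unfolding w_def using complex_root_unity[of n j] assms by auto
  ultimately show ?thesis by (simp add: geometric_sum)
qed

text \<open>Rickart's argument: averaging the resolvent \<open>(q - \<mu> x)\<inverse>\<close> over the \<open>n\<close>-th roots of unity
  times \<open>r\<close> gives \<open>(q - r ^ n x ^ n)\<inverse>\<close>, and these averages are Lipschitz in \<open>r\<close> uniformly in \<open>n\<close>.
  This propagates \<open>r ^ n x ^ n \<longlonglongrightarrow> 0\<close> from small \<open>r\<close> to all \<open>r\<close>, which is absurd
  for invertible \<open>x\<close> unless \<open>q = 0\<close>.\<close>

theorem gelfand_mazur:
  fixes q x :: "'a::cbanach_algebra"
  assumes q: "q * q = q" and x: "x \<in> corner q"
    and inv: "\<And>\<mu>. \<exists>u\<in>corner q. (x - scaleC \<mu> q) * u = q \<and> u * (x - scaleC \<mu> q) = q"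
  shows "q = 0"
proof -
  have qc: "q \<in> corner q" using q by (simp add: corner_def)
  have sub: "a - c = b" if "a - b = c" for a b c :: 'a using that by auto
  have "\<exists>g\<in>corner q. (q - scaleC \<mu> x) * g = q \<and> g * (q - scaleC \<mu> x) = q" for \<mu>
  proof (cases "\<mu> = 0")
    case False
    obtain u where u: "u \<in> corner q" "(x - scaleC (1/\<mu>) q) * u = q" "u * (x - scaleC (1/\<mu>) q) = q"
      using inv by blast
    have "q - scaleC \<mu> x = scaleC (- \<mu>) (x - scaleC (1/\<mu>) q)"
      using False by (simp add: scaleC_diff_right scaleC_scaleC scaleC_minus_left)
    then show ?thesis
      using u False by (intro bexI[of _ "scaleC (- (1/\<mu>)) u"])
        (auto simp: mult_scaleC_left mult_scaleC_right scaleC_scaleC intro: corner_scaleC)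
  qed (use q qc in auto)
  then obtain G where Gc: "\<And>\<mu>. G \<mu> \<in> corner q" and G1: "\<And>\<mu>. (q - scaleC \<mu> x) * G \<mu> = q"
    and G2: "\<And>\<mu>. G \<mu> * (q - scaleC \<mu> x) = q" by metis
  have resolvent: "G \<mu> - G \<nu> = scaleC (\<mu> - \<nu>) (G \<mu> * x * G \<nu>)" for \<mu> \<nu>
  proof -
    have "G \<mu> - G \<nu> = G \<mu> * ((q - scaleC \<nu> x) * G \<nu>) - (G \<mu> * (q - scaleC \<mu> x)) * G \<nu>"
      by (simp add: G1 G2 cornerD[OF Gc])
    also have "\<dots> = G \<mu> * ((q - scaleC \<nu> x) - (q - scaleC \<mu> x)) * G \<nu>"
      by (simp add: algebra_simps)
    also have "\<dots> = scaleC (\<mu> - \<nu>) (G \<mu> * x * G \<nu>)"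
      by (simp add: scaleC_diff_left algebra_simps mult_scaleC_left mult_scaleC_right)
    finally show ?thesis .
  qed
  have lip: "norm (G \<mu> - G \<nu>) \<le> cmod (\<mu> - \<nu>) * (norm (G \<mu>) * norm x * norm (G \<nu>))" for \<mu> \<nu>
    unfolding resolvent norm_scaleC
    by (intro mult_left_mono order_trans[OF norm_mult_ineq] mult_right_mono norm_mult_ineq) auto
  \<comment> \<open>The bound \<open>lip\<close> involves \<open>G \<mu>\<close> itself; near
    \<open>\<nu>\<close> it first forces \<open>norm (G \<mu>) \<le> 2 * norm (G \<nu>)\<close>, and
    then yields continuity.\<close>
  have "isCont G \<nu>" for \<nu>
  proof -
    define K where "K = norm x * norm (G \<nu>)"
    have K: "K \<ge> 0" by (simp add: K_def)
    have "((\<lambda>\<mu>. cmod (\<mu> - \<nu>) * K) \<longlongrightarrow> cmod (\<nu> - \<nu>) * K) (at \<nu>)"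
      by (intro tendsto_intros)
    then have "\<forall>\<^sub>F \<mu> in at \<nu>. cmod (\<mu> - \<nu>) * K < 1/2"
      by (rule order_tendstoD(2)) auto
    then have "\<forall>\<^sub>F \<mu> in at \<nu>. norm (G \<mu> - G \<nu>) \<le> cmod (\<mu> - \<nu>) * (2 * norm (G \<nu>) * K)"
    proof eventually_elim
      case (elim \<mu>)
      have l: "norm (G \<mu> - G \<nu>) \<le> (cmod (\<mu> - \<nu>) * K) * norm (G \<mu>)"
        using lip[of \<mu> \<nu>] by (simp add: K_def mult_ac)
      also have "\<dots> \<le> 1/2 * norm (G \<mu>)" using elim by (intro mult_right_mono) auto
      finally have "norm (G \<mu>) \<le> 2 * norm (G \<nu>)"
        using norm_triangle_ineq2[of "G \<mu>" "G \<nu>"] by linarith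
      then have "(cmod (\<mu> - \<nu>) * K) * norm (G \<mu>) \<le> (cmod (\<mu> - \<nu>) * K) * (2 * norm (G \<nu>))"
        using K by (intro mult_left_mono) auto
      then show ?case using l by (simp add: mult_ac)
    qed
    moreover have "((\<lambda>\<mu>. cmod (\<mu> - \<nu>) * (2 * norm (G \<nu>) * K)) \<longlongrightarrow> 0) (at \<nu>)"
      by (auto intro!: tendsto_eq_intros)
    ultimately have "((\<lambda>\<mu>. G \<mu> - G \<nu>) \<longlongrightarrow> 0) (at \<nu>)"
      by (rule Lim_null_comparison)
    then show ?thesis using LIM_zero_cancel isCont_def by blast
  qed
  then have contG: "continuous_on UNIV G" by (simp add: continuous_on_eq_continuous_at)
  define g where "g n r = (1 / real n) *\<^sub>R
    (\<Sum>k<n. G (exp (2 * of_real pi * \<i> * of_nat k / of_nat n) * of_real r))" for n and r :: real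
  \<comment> \<open>Each resolvent turns into a polynomial in \<open>w k * r * x\<close> of degree
    below \<open>n\<close>; the sum over the roots of unity keeps only its constant term.\<close>
  have g: "(q - scaleC (of_real r ^ n) (upow q x n)) * g n r = q" if n: "n > 0" for n r
  proof -
    define w where "w k = exp (2 * of_real pi * \<i> * of_nat k / of_nat n)" for k
    have "(q - scaleC (of_real r ^ n) (upow q x n)) * G (w k * of_real r)
       = (\<Sum>j<n. scaleC ((w k * of_real r) ^ j) (upow q x j))" for k
    proof -
      let ?y = "scaleC (w k * of_real r) x"
      have y: "?y \<in> corner q" using x by (rule corner_scaleC)
      have "w k ^ n = 1" unfolding w_def using n complex_root_unity by simp
      then have "q - scaleC (of_real r ^ n) (upow q x n) = q - upow q ?y n"
        by (simp add: upow_scaleC power_mult_distrib)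
      also have "\<dots> = (\<Sum>j<n. upow q ?y j) * (q - ?y)" by (rule upow_telescope[OF q y, symmetric])
      finally have "(q - scaleC (of_real r ^ n) (upow q x n)) * G (w k * of_real r)
         = (\<Sum>j<n. upow q ?y j) * q" by (simp add: mult.assoc G1)
      also have "\<dots> = (\<Sum>j<n. upow q ?y j)"
        by (simp add: sum_distrib_right cornerD(2)[OF upow_corner[OF q y]])
      finally show ?thesis by (simp add: upow_scaleC)
    qed
    then have "(q - scaleC (of_real r ^ n) (upow q x n)) * (\<Sum>k<n. G (w k * of_real r))
       = (\<Sum>k<n. \<Sum>j<n. scaleC ((w k * of_real r) ^ j) (upow q x j))"
      by (simp add: sum_distrib_left)
    also have "\<dots> = (\<Sum>j<n. \<Sum>k<n. scaleC ((w k * of_real r) ^ j) (upow q x j))"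
      by (rule sum.swap)
    also have "\<dots> = (\<Sum>j<n. scaleC ((\<Sum>k<n. w k ^ j) * of_real r ^ j) (upow q x j))"
      by (simp add: scaleC_sum_left sum_distrib_right power_mult_distrib)
    also have "\<dots> = (\<Sum>j<n. if j = 0 then real n *\<^sub>R q else 0)"
    proof (intro sum.cong refl)
      fix j assume j: "j \<in> {..<n}"
      show "scaleC ((\<Sum>k<n. w k ^ j) * of_real r ^ j) (upow q x j) = (if j = 0 then real n *\<^sub>R q else 0)"
        using sum_powers_root_of_unity[of j n] j scaleC_of_real[of "real n" q] by (auto simp: w_def)
    qed
    also have "\<dots> = real n *\<^sub>R q" using n by simp
    finally show ?thesis using n unfolding g_def w_def by simp
  qed
  have conv: "(\<lambda>n. r ^ n *\<^sub>R upow q x n) \<longlonglongrightarrow> 0" if r: "r \<ge> 0" for r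
  proof -
    define R where "R = r + 1"
    have "bounded (G ` cball 0 R)"
      using contG by (intro compact_imp_bounded compact_continuous_image continuous_on_subset[OF contG]) auto
    then obtain C where C: "C > 0" "\<And>\<mu>. cmod \<mu> \<le> R \<Longrightarrow> norm (G \<mu>) \<le> C"
      unfolding bounded_pos by auto
    define L where "L = C * norm x * C + 1"
    have L: "L > 0" using C by (simp add: L_def add_nonneg_pos)
    have Glip: "norm (G \<mu> - G \<nu>) \<le> L * cmod (\<mu> - \<nu>)" if "cmod \<mu> \<le> R" "cmod \<nu> \<le> R" for \<mu> \<nu>
    proof -
      have "norm (G \<mu>) * norm x * norm (G \<nu>) \<le> C * norm x * C"
        using C that by (intro mult_mono) auto
      then have "norm (G \<mu>) * norm x * norm (G \<nu>) \<le> L" by (simp add: L_def)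
      then show ?thesis using order_trans[OF lip[of \<mu> \<nu>] mult_left_mono] by (auto simp: mult_ac)
    qed
    have cm: "cmod (exp (2 * of_real pi * \<i> * of_nat k / of_nat n) * of_real t) = \<bar>t\<bar>" for k n t
      by (simp add: norm_mult norm_exp_eq_Re)
    have gC: "norm (g n t) \<le> C" if "0 \<le> t" "t \<le> R" "n > 0" for n t
    proof -
      have "norm (\<Sum>k<n. G (exp (2 * of_real pi * \<i> * of_nat k / of_nat n) * of_real t)) \<le> (\<Sum>k<n. C)"
        using that by (intro order_trans[OF norm_sum] sum_mono C(2)) (simp add: cm)
      then show ?thesis using that by (simp add: g_def field_simps)
    qed
    have gL: "norm (g n t - g n t') \<le> L * \<bar>t - t'\<bar>"
      if t: "0 \<le> t" "t \<le> R" "0 \<le> t'" "t' \<le> R" and n: "n > 0" for n t t'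
    proof -
      let ?w = "\<lambda>k. exp (2 * of_real pi * \<i> * of_nat k / of_nat n) :: complex"
      have *: "norm (G (?w k * of_real t) - G (?w k * of_real t')) \<le> L * \<bar>t - t'\<bar>" for k
      proof -
        have "cmod (?w k * of_real t - ?w k * of_real t') = \<bar>t - t'\<bar>"
          using cm[of k n "t - t'"] by (simp add: right_diff_distrib)
        then show ?thesis using Glip[of "?w k * of_real t" "?w k * of_real t'"] t by (simp add: cm)
      qed
      have "norm (\<Sum>k<n. G (?w k * of_real t) - G (?w k * of_real t')) \<le> (\<Sum>k<n. L * \<bar>t - t'\<bar>)"
        by (intro order_trans[OF norm_sum] sum_mono *)
      moreover have "g n t - g n t' = (1 / real n) *\<^sub>R (\<Sum>k<n. G (?w k * of_real t) - G (?w k * of_real t'))"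
        by (simp add: g_def sum_subtractf scaleR_diff_right)
      ultimately show ?thesis using n by (simp add: field_simps)
    qed
    \<comment> \<open>A move of the radius by at most \<open>2 * \<eta>\<close> changes
      \<open>g n\<close> by at most \<open>1/4\<close>. This holds for all \<open>n\<close> and all
      radii up to \<open>R\<close>, so finitely many steps reach \<open>r\<close>.\<close>
    define \<eta> where "\<eta> = 1 / (8 * L)"
    have \<eta>: "\<eta> > 0" using L by (simp add: \<eta>_def)
    have step: "(\<lambda>n. t' ^ n *\<^sub>R upow q x n) \<longlonglongrightarrow> 0"
      if lim: "(\<lambda>n. t ^ n *\<^sub>R upow q x n) \<longlonglongrightarrow> 0" and t: "0 \<le> t" "t \<le> t'" "t' < R" "t' \<le> t + \<eta>" for t t'
    proof -
      \<comment> \<open>Overshooting \<open>t'\<close>: boundedness at the larger radius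
        \<open>s\<close> gives geometric decay at \<open>t'\<close>.\<close>
      define s where "s = min R (t' + \<eta>)"
      have s: "t' < s" "s \<le> R" "s - t \<le> 2 * \<eta>" "t \<le> s" "0 < s" using t \<eta> by (auto simp: s_def)
      have "(\<lambda>n. norm (t ^ n *\<^sub>R upow q x n) * C) \<longlonglongrightarrow> 0 * C"
        by (intro tendsto_intros tendsto_norm_zero lim)
      then have "\<forall>\<^sub>F n in sequentially. norm (t ^ n *\<^sub>R upow q x n) * C < 1/4"
        by (rule order_tendstoD(2)) auto
      then have bd: "\<forall>\<^sub>F n in sequentially. norm (s ^ n *\<^sub>R upow q x n) \<le> 1"
        using eventually_gt_at_top[of 0]
      proof eventually_elim
        case (elim n)
        have "g n t - q = scaleC (of_real t ^ n) (upow q x n) * g n t"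
        proof -
          have "q * g n t = g n t"
            unfolding g_def by (simp add: sum_distrib_left cornerD(1)[OF Gc])
          then have "g n t - scaleC (of_real t ^ n) (upow q x n) * g n t = q"
            using g[of n t] elim by (simp add: left_diff_distrib)
          then show ?thesis by (rule sub)
        qed
        then have "norm (g n t - q) \<le> norm (t ^ n *\<^sub>R upow q x n) * norm (g n t)"
          using scaleC_of_real[of "t ^ n" "upow q x n"] by (metis norm_mult_ineq of_real_power)
        also have "\<dots> \<le> norm (t ^ n *\<^sub>R upow q x n) * C"
          using gC[of t n] elim t by (intro mult_left_mono) auto
        finally have 1: "norm (g n t - q) \<le> 1/4" using elim by simp
        have "norm (g n s - g n t) \<le> L * (s - t)" using gL[of s t n] s t elim by auto
        also have "\<dots> \<le> L * (2 * \<eta>)" using s L by (intro mult_left_mono) auto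
        also have "\<dots> = 1/4" using L by (simp add: \<eta>_def)
        finally have 2: "norm (g n s - q) \<le> 1/2"
          using 1 norm_triangle_ineq[of "g n s - g n t" "g n t - q"] by simp
        define z where "z = s ^ n *\<^sub>R upow q x n"
        have z: "z * q = z" using cornerD(2)[OF upow_corner[OF q x]] by (simp add: z_def)
        have "q * g n s = g n s"
          unfolding g_def by (simp add: sum_distrib_left cornerD(1)[OF Gc])
        then have "g n s - z * g n s = q"
          using g[of n s] elim scaleC_of_real[of "s ^ n" "upow q x n"]
          by (simp add: z_def left_diff_distrib)
        then have "z * g n s = g n s - q" by (rule sub[symmetric])
        \<comment> \<open>Since \<open>norm (g n s - q) \<le> 1/2\<close>, this identity bounds
          \<open>norm z\<close> by half of \<open>1 + norm z\<close>, hence by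
          \<open>1\<close>.\<close>
        then have "z = (g n s - q) - z * (g n s - q)" using z by (simp add: right_diff_distrib)
        then have "norm z \<le> norm (g n s - q) + norm (z * (g n s - q))"
          by (metis norm_triangle_ineq4)
        also have "\<dots> \<le> norm (g n s - q) + norm z * norm (g n s - q)"
          by (intro add_left_mono norm_mult_ineq)
        also have "\<dots> \<le> 1/2 + norm z * (1/2)" using 2 by (intro add_mono mult_left_mono) auto
        finally show ?case by (simp add: z_def)
      qed
      have "\<forall>\<^sub>F n in sequentially. norm (t' ^ n *\<^sub>R upow q x n) \<le> (t' / s) ^ n"
        using bd
      proof eventually_elim
        case (elim n)
        have "norm (t' ^ n *\<^sub>R upow q x n) = (t' / s) ^ n * norm (s ^ n *\<^sub>R upow q x n)"
          using s t by (simp add: power_divide)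
        also have "\<dots> \<le> (t' / s) ^ n * 1" using elim s t by (intro mult_left_mono) auto
        finally show ?case by simp
      qed
      moreover have "(\<lambda>n. (t' / s) ^ n) \<longlonglongrightarrow> 0"
        using s t by (intro LIMSEQ_power_zero) auto
      ultimately show ?thesis by (rule Lim_null_comparison)
    qed
    have "(\<lambda>n. (min r (real i * \<eta>)) ^ n *\<^sub>R upow q x n) \<longlonglongrightarrow> 0" for i
    proof (induction i)
      \<comment> \<open>Only \<open>n > 0\<close> counts, as \<open>0 ^ 0 = 1\<close>.\<close>
      case 0
      have "\<forall>\<^sub>F n in sequentially. (min r (real 0 * \<eta>)) ^ n *\<^sub>R upow q x n = 0"
        using eventually_gt_at_top[of 0] by eventually_elim (use r in auto)
      then show ?case by (rule tendsto_eventually)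
    next
      case (Suc i)
      show ?case by (rule step[OF Suc]) (use r \<eta> in \<open>auto simp: R_def algebra_simps min_def\<close>)
    qed
    moreover obtain i where "r < real i * \<eta>" using \<eta> reals_Archimedean3 by blast
    ultimately show ?thesis by (metis min.absorb3)
  qed
  obtain v where v: "v \<in> corner q" "x * v = q" using inv[of 0] by auto
  \<comment> \<open>\<open>norm v / c < 1\<close> makes \<open>v ^ n / c ^ n\<close> a null
    sequence; as \<open>x ^ n * v ^ n = q\<close>, the constant \<open>q\<close> is then a product
    of null sequences.\<close>
  define c where "c = 2 * norm v + 1"
  have c: "c > 0" by (simp add: c_def add_nonneg_pos)
  have xv: "upow q x n * upow q v n = q" for n
  proof (induction n)
    case (Suc n)
    have "upow q x (Suc n) * upow q v (Suc n) = upow q x n * (x * v) * upow q v n"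
      unfolding upow_Suc2[OF q x] upow_Suc[of q v] by (simp add: mult.assoc)
    then show ?case using Suc cornerD(2)[OF upow_corner[OF q x]] by (simp add: v)
  qed (simp add: q)
  have "(\<lambda>n. (c ^ n *\<^sub>R upow q x n) * ((1/c) ^ n *\<^sub>R upow q v n)) \<longlonglongrightarrow> 0"
  proof (rule tendsto_mult_zero[OF conv])
    show "(\<lambda>n. (1/c) ^ n *\<^sub>R upow q v n) \<longlonglongrightarrow> 0"
    proof (rule Lim_null_comparison)
      have "norm ((1/c) ^ n *\<^sub>R upow q v n) \<le> norm q * (norm v / c) ^ n" for n
        using mult_left_mono[OF norm_upow_le[of q v n], of "(1/c) ^ n"] c
        by (simp add: power_divide)
      then show "\<forall>\<^sub>F n in sequentially. norm ((1/c) ^ n *\<^sub>R upow q v n) \<le> norm q * (norm v / c) ^ n"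
        by simp
      have "(\<lambda>n. norm q * (norm v / c) ^ n) \<longlonglongrightarrow> norm q * 0"
        using c by (intro tendsto_intros LIMSEQ_power_zero) (auto simp: c_def)
      then show "(\<lambda>n. norm q * (norm v / c) ^ n) \<longlonglongrightarrow> 0" by simp
    qed
  qed (use c in simp)
  moreover have "(c ^ n *\<^sub>R upow q x n) * ((1/c) ^ n *\<^sub>R upow q v n) = q" for n
    using c by (simp add: xv power_divide)
  ultimately show "q = 0" by (simp add: LIMSEQ_const_iff)
qed

section \<open>Derivations on commutative semisimple corners\<close>

text \<open>\<open>D\<close> acts on the whole Banach space with values in the corner, so the closed
  graph argument applies to it directly. \<open>semisimple\<close> says that the corner has zero
  Jacobson radical; by commutativity one-sided inverses suffice.\<close>

locale corner_derivation =
  fixes e :: "'a::cbanach_algebra" and D :: "'a \<Rightarrow> 'a"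
  assumes right_id: "a * e = a"
    and comm: "x \<in> corner e \<Longrightarrow> y \<in> corner e \<Longrightarrow> x * y = y * x"
    and D_clinear: "clinear_map D"
    and D_corner: "D x \<in> corner e"
    and D_mult: "b \<in> corner e \<Longrightarrow> D (b * x) = D b * x + b * D x"
    and semisimple: "x \<in> corner e \<Longrightarrow> (\<And>b. b \<in> corner e \<Longrightarrow> \<exists>u\<in>corner e. (e - b * x) * u = e) \<Longrightarrow> x = 0"
begin

abbreviation "S \<equiv> separating_space D"

section \<open>The separating space as an ideal of the corner\<close>

lemma e_idem: "e * e = e" and e_corner: "e \<in> corner e"
  by (simp_all add: corner_def right_id)

lemma corner_left_ideal: "b \<in> corner e \<Longrightarrow> b * x \<in> corner e"
  by (simp add: corner_def right_id mult.assoc[symmetric])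

lemma left_comm: "x \<in> corner e \<Longrightarrow> y \<in> corner e \<Longrightarrow> x * (y * z) = y * (x * z)"
  using comm by (metis mult.assoc)

lemma D_scaleC: "D (scaleC c x) = scaleC c (D x)"
  using D_clinear by (simp add: clinear_map_def)

lemma linear_D: "linear D"
  using D_clinear by (intro linearI) (auto simp: clinear_map_def simp flip: scaleC_of_real)

lemmas D_add = linear_add[OF linear_D] and D_diff = linear_diff[OF linear_D]

lemma S_corner: "s \<in> S \<Longrightarrow> s \<in> corner e"
proof -
  assume s: "s \<in> S"
  have "s \<in> closure (corner e)"
    unfolding closure_approachable dist_norm
    using separating_spaceD[OF s] D_corner by blast
  then show ?thesis using closed_corner[of e] by simp
qed

text \<open>If \<open>x\<close> is small and \<open>D x\<close> is near \<open>s\<close>, then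
  \<open>D (b * x) = D b * x + b * D x\<close> is near \<open>b * s\<close>.\<close>

lemma S_ideal:
  assumes b: "b \<in> corner e" and s: "s \<in> S"
  shows "b * s \<in> S"
  unfolding separating_space_def
proof (intro CollectI allI impI)
  fix \<epsilon> :: real assume \<epsilon>: "\<epsilon> > 0"
  define K where "K = norm b + norm (D b) + 1"
  have K: "K > 0" by (simp add: K_def add_nonneg_pos)
  obtain x where x: "norm x < \<epsilon> / K" "norm (D x - s) < \<epsilon> / K"
    using separating_spaceD[OF s, of "\<epsilon> / K"] \<epsilon> K by auto
  have K\<epsilon>: "(norm b + norm (D b)) * (\<epsilon> / K) < \<epsilon>"
  proof -
    have "(norm b + norm (D b)) * (\<epsilon> / K) < K * (\<epsilon> / K)"
      using \<epsilon> K by (intro mult_strict_right_mono) (auto simp: K_def)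
    then show ?thesis using K by simp
  qed
  have "norm (b * x) \<le> norm b * norm x" by (rule norm_mult_ineq)
  also have "\<dots> \<le> (norm b + norm (D b)) * (\<epsilon> / K)" using x by (intro mult_mono) auto
  finally have 1: "norm (b * x) < \<epsilon>" using K\<epsilon> by linarith
  have "D (b * x) - b * s = D b * x + b * (D x - s)" by (simp add: D_mult[OF b] algebra_simps)
  then have "norm (D (b * x) - b * s) \<le> norm (D b) * norm x + norm b * norm (D x - s)"
    using norm_triangle_ineq[of "D b * x" "b * (D x - s)"] norm_mult_ineq[of "D b" x]
      norm_mult_ineq[of b "D x - s"] by simp
  also have "\<dots> \<le> norm (D b) * (\<epsilon> / K) + norm b * (\<epsilon> / K)"
    using x by (intro add_mono mult_left_mono) auto
  also have "\<dots> < \<epsilon>" using K\<epsilon> by (simp add: algebra_simps)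
  finally show "\<exists>x. norm x < \<epsilon> \<and> norm (D x - b * s) < \<epsilon>" using 1 by blast
qed

text \<open>Otherwise there is a sequence \<open>b n\<close>, each a multiple of the previous one, with \<open>b n S\<close> having
  strictly decreasing closures. For suitable small \<open>x n\<close> the sum of the \<open>b n * x n\<close> would have an
  image under \<open>D\<close> of infinite norm: modulo the closure of \<open>b (n + 1) S\<close>, \<open>D\<close> is bounded on the
  tail, because the tail is exactly \<open>b (n + 1)\<close> times a small element.\<close>

lemma stability:
  assumes S0: "\<exists>s\<in>S. s \<noteq> 0"
  obtains b where "b \<in> corner e" "\<exists>s\<in>S. b * s \<noteq> 0"
    "\<forall>c\<in>corner e. (\<forall>s\<in>S. b * c * s = 0) \<or> (\<forall>s\<in>S. b * s \<in> closure ((\<lambda>s. b * c * s) ` S))"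
proof (rule ccontr)
  assume no: "\<not> thesis"
  have "\<exists>c. b \<in> corner e \<and> (\<exists>s\<in>S. b * s \<noteq> 0) \<longrightarrow>
      c \<in> corner e \<and> (\<exists>s\<in>S. b * c * s \<noteq> 0) \<and> (\<exists>s\<in>S. b * s \<notin> closure ((\<lambda>s. b * c * s) ` S))" for b
    using that[of b] no by blast
  then obtain cf where cf: "\<And>b. b \<in> corner e \<Longrightarrow> \<exists>s\<in>S. b * s \<noteq> 0 \<Longrightarrow>
      cf b \<in> corner e \<and> (\<exists>s\<in>S. b * cf b * s \<noteq> 0) \<and> (\<exists>s\<in>S. b * s \<notin> closure ((\<lambda>s. b * cf b * s) ` S))"
    by metis
  define b where "b = rec_nat e (\<lambda>_ b. b * cf b)"
  define c where "c n = cf (b n)" for n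
  have b0: "b 0 = e" and bS: "b (Suc n) = b n * c n" for n by (auto simp: b_def c_def)
  have inv: "b n \<in> corner e \<and> (\<exists>s\<in>S. b n * s \<noteq> 0)" for n
  proof (induction n)
    case 0
    then show ?case using S0 e_corner S_corner cornerD(1) by (metis b0)
  next
    case (Suc n)
    then show ?case using cf[of "b n"] corner_mult by (auto simp: bS c_def)
  qed
  have bc: "b n \<in> corner e" for n using inv by blast
  have cc: "c n \<in> corner e" for n using cf inv by (simp add: c_def)
  have "\<exists>s\<in>S. \<exists>\<eta>>0. \<forall>s'\<in>S. norm (b n * s - b (Suc n) * s') \<ge> \<eta>" for n
  proof -
    obtain s where s: "s \<in> S" "b n * s \<notin> closure ((\<lambda>s. b (Suc n) * s) ` S)"
      using cf[of "b n"] inv[of n] by (auto simp: bS c_def)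
    then show ?thesis
      unfolding closure_approachable by (auto simp: dist_norm norm_minus_commute not_less)
  qed
  then obtain s \<eta> where sS: "\<And>n. s n \<in> S" and \<eta>0: "\<And>n. \<eta> n > 0"
    and \<eta>: "\<And>n s'. s' \<in> S \<Longrightarrow> norm (b n * s n - b (Suc n) * s') \<ge> \<eta> n" by metis
  obtain M where M: "M \<ge> 0" "\<And>y. \<exists>s\<in>S. norm (D y - s) \<le> M * norm y"
    using dist_separating_space_bounded[OF linear_D] by metis

  \<comment> \<open>\<open>p m j\<close> is the product of \<open>c m\<close>, ...,
    \<open>c (m + j - 1)\<close>, the cofactor of \<open>b m\<close> in
    \<open>b (m + j)\<close>.\<close>
  define p where "p m j = rec_nat e (\<lambda>j u. u * c (m + j)) j" for m j
  have p0: "p m 0 = e" and pS: "p m (Suc j) = p m j * c (m + j)" for m j by (auto simp: p_def)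
  have bp: "b (m + j) = b m * p m j" for m j
    by (induction j) (auto simp: p0 pS right_id bS mult.assoc)
  \<comment> \<open>\<open>A m\<close> bounds the distance of \<open>D (b m * y)\<close> from
    \<open>b m * S\<close> per unit of \<open>norm y\<close>. \<open>E i\<close> collects the
    constraints on the size of \<open>x i\<close>: one for each tail starting at some
    \<open>m \<le> i\<close>, with a power of \<open>2\<close> for summability, and those for the
    error terms at index \<open>i\<close>.\<close>
  define A where "A m = norm (D (b m)) + norm (b m) * M + 1" for m
  have A: "A m > 0" for m using M by (simp add: A_def add_nonneg_pos)
  define E where "E i = (\<Sum>m\<le>i. norm (p m (i - m)) * A m) * 2 ^ (i + 1) + norm (D (b i)) + norm (b i) + 1" for i
  have E: "E i \<ge> 1" for i
    unfolding E_def using A by (simp add: sum_nonneg less_imp_le)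
  define \<epsilon> where "\<epsilon> i = 1 / E i" for i
  have \<epsilon>0: "\<epsilon> i > 0" for i using E[of i] by (simp add: \<epsilon>_def)
  have \<epsilon>1: "norm (p m j) * A m * \<epsilon> (m + j) \<le> (1/2) ^ (Suc j)" for m j
  proof -
    have "norm (p m j) * A m = norm (p m (m + j - m)) * A m" by simp
    also have "\<dots> \<le> (\<Sum>k\<le>m + j. norm (p k (m + j - k)) * A k)"
      using A by (intro member_le_sum[where f = "\<lambda>k. norm (p k (m + j - k)) * A k"]) (auto simp: less_imp_le)
    finally have "norm (p m j) * A m * 2 ^ (m + j + 1) \<le> E (m + j)"
      unfolding E_def by (smt (verit) mult_right_mono norm_ge_zero zero_le_power)
    moreover have "norm (p m j) * A m * 2 ^ (Suc j) \<le> norm (p m j) * A m * 2 ^ (m + j + 1)"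
      using A[of m] by (intro mult_left_mono power_increasing) auto
    ultimately show ?thesis
      using E[of "m + j"] by (simp add: \<epsilon>_def field_simps)
  qed
  have \<epsilon>2: "(norm (D (b i)) + norm (b i)) * \<epsilon> i \<le> 1" for i
  proof -
    have "(\<Sum>m\<le>i. norm (p m (i - m)) * A m) * 2 ^ (i + 1) \<ge> 0"
      using A by (intro mult_nonneg_nonneg sum_nonneg) (auto simp: less_imp_le)
    then have "norm (D (b i)) + norm (b i) \<le> E i" unfolding E_def by simp
    then show ?thesis using E[of i] by (simp add: \<epsilon>_def)
  qed
  \<comment> \<open>The jump at index \<open>n\<close> must outweigh the image of the partial sum
    \<open>w\<close> by \<open>n\<close>; the \<open>4\<close> absorbs errors of total size at most
    \<open>2\<close>. As the size depends on \<open>w\<close>, the small elements are chosen for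
    every \<open>w\<close> before the recursion.\<close>
  define t where "t n w = (real n + norm (D w) + 4) / \<eta> n" for n w
  have t: "t n w > 0" for n w using \<eta>0[of n] by (simp add: t_def add_nonneg_pos)
  have "\<exists>x. norm x < \<epsilon> n \<and> norm (D x - t n w *\<^sub>R s n) < \<epsilon> n" for n w
    by (intro separating_spaceD separating_space_scaleR linear_D sS \<epsilon>0)
  then obtain f where f: "\<And>n w. norm (f n w) < \<epsilon> n" "\<And>n w. norm (D (f n w) - t n w *\<^sub>R s n) < \<epsilon> n"
    by metis
  define w where "w = rec_nat 0 (\<lambda>n w. w + b n * f n w)"
  define x where "x n = f n (w n)" for n
  have w0: "w 0 = 0" and wS: "w (Suc n) = w n + b n * x n" for n by (auto simp: w_def x_def)
  have w: "w n = (\<Sum>i<n. b i * x i)" for n by (induction n) (auto simp: w0 wS)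
  have x: "norm (x n) < \<epsilon> n" "norm (D (x n) - t n (w n) *\<^sub>R s n) < \<epsilon> n" for n
    using f by (auto simp: x_def)
  have pterm: "norm (p m j * x (m + j)) \<le> (1 / A m) * (1/2) ^ Suc j" for m j
  proof -
    have "norm (p m j * x (m + j)) \<le> norm (p m j) * norm (x (m + j))" by (rule norm_mult_ineq)
    also have "\<dots> \<le> norm (p m j) * \<epsilon> (m + j)" using x(1)[of "m + j"] by (intro mult_left_mono) auto
    finally have "A m * norm (p m j * x (m + j)) \<le> A m * (norm (p m j) * \<epsilon> (m + j))"
      using A[of m] by (intro mult_left_mono) auto
    also have "\<dots> \<le> (1/2) ^ Suc j" using \<epsilon>1[of m j] by (simp add: mult_ac)
    finally show ?thesis using A[of m] by (simp add: pos_le_divide_eq mult.commute)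
  qed
  have sg: "(\<lambda>j. (1 / A m) * (1/2) ^ Suc j) sums (1 / A m)" for m
    using sums_mult[OF power_half_series, of "1 / A m"] by simp
  define y where "y m = (\<Sum>j. p m j * x (m + j))" for m
  have sm: "summable (\<lambda>j. p m j * x (m + j))" for m
    by (rule summable_comparison_test'[OF sums_summable[OF sg[of m]]]) (use pterm in auto)
  have yA: "A m * norm (y m) \<le> 1" for m
  proof -
    have "norm (y m) \<le> 1 / A m"
      unfolding y_def using norm_suminf_le[OF pterm sums_summable[OF sg]] sums_unique[OF sg] by metis
    then show ?thesis using A[of m] by (simp add: field_simps)
  qed
  have split: "y 0 = w n + b n * y n" for n
  proof -
    have p0b: "p 0 j = b j" for j by (induction j) (auto simp: p0 b0 bS pS)
    have "y 0 = (\<Sum>j. b (j + n) * x (j + n)) + w n"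
      unfolding y_def w p0b[symmetric] using suminf_split_initial_segment[OF sm[of 0], of n] by simp
    also have "(\<Sum>j. b (j + n) * x (j + n)) = (\<Sum>j. b n * (p n j * x (n + j)))"
      using bp[of n] by (simp add: mult.assoc add.commute)
    also have "\<dots> = b n * y n" unfolding y_def by (rule suminf_mult[OF sm])
    finally show ?thesis by simp
  qed
  have "real n \<le> norm (D (y 0))" for n
  proof -
    let ?y = "y (Suc n)" and ?t = "t n (w n)"
    \<comment> \<open>\<open>s'\<close> stands in for \<open>D\<close> of the tail; by the choice of
      \<open>\<eta> n\<close>, no element of \<open>b (Suc n) * S\<close> can cancel the jump along
      \<open>b n * s n\<close>.\<close>
    obtain s' where s': "s' \<in> S" "norm (D ?y - s') \<le> M * norm ?y" using M by blast
    have "(- (1 / ?t)) *\<^sub>R s' \<in> S" by (rule separating_space_scaleR[OF linear_D s'(1)])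
    from \<eta>[OF this, of n] have "?t * \<eta> n \<le> ?t * norm (b n * s n + (1 / ?t) *\<^sub>R (b (Suc n) * s'))"
      using t[of n "w n"] by (intro mult_left_mono) auto
    also have "\<dots> = norm (?t *\<^sub>R (b n * s n + (1 / ?t) *\<^sub>R (b (Suc n) * s')))"
      using t[of n "w n"] by simp
    also have "?t *\<^sub>R (b n * s n + (1 / ?t) *\<^sub>R (b (Suc n) * s')) = ?t *\<^sub>R (b n * s n) + b (Suc n) * s'"
      using t[of n "w n"] by (simp add: scaleR_add_right)
    also have "\<dots> = D (y 0) - D (w n) - D (b n) * x n - b n * (D (x n) - ?t *\<^sub>R s n)
        - D (b (Suc n)) * ?y - b (Suc n) * (D ?y - s')"
    proof -
      have "D (y 0) = D (w n) + (D (b n) * x n + b n * D (x n)) + (D (b (Suc n)) * ?y + b (Suc n) * D ?y)"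
        using split[of "Suc n"] by (simp add: wS D_add D_mult[OF bc])
      then show ?thesis by (simp add: right_diff_distrib)
    qed
    also have "norm \<dots> \<le> norm (D (y 0)) + norm (D (w n)) + norm (D (b n) * x n)
        + norm (b n * (D (x n) - ?t *\<^sub>R s n)) + norm (D (b (Suc n)) * ?y) + norm (b (Suc n) * (D ?y - s'))"
      by (intro order_trans[OF norm_triangle_ineq4] add_right_mono) auto
    also have "\<dots> \<le> norm (D (y 0)) + norm (D (w n)) + norm (D (b n)) * \<epsilon> n
        + norm (b n) * \<epsilon> n + norm (D (b (Suc n))) * norm ?y + norm (b (Suc n)) * (M * norm ?y)"
      by (intro add_mono order_refl order_trans[OF norm_mult_ineq] mult_left_mono less_imp_le[OF x(1)]
          less_imp_le[OF x(2)] s'(2) norm_ge_zero)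
    also have "\<dots> \<le> norm (D (y 0)) + norm (D (w n)) + 1 + 1"
    proof -
      have "norm (D (b (Suc n))) * norm ?y + norm (b (Suc n)) * (M * norm ?y) \<le> A (Suc n) * norm ?y"
        by (simp add: A_def algebra_simps)
      then show ?thesis using yA[of "Suc n"] \<epsilon>2[of n] by (simp add: algebra_simps)
    qed
    finally show ?thesis using \<eta>0[of n] by (simp add: t_def)
  qed
  then show False using reals_Archimedean2[of "norm (D (y 0))"] by (meson leD)
qed

lemma S_trivial: "S = {0}"
proof (rule ccontr)
  assume "S \<noteq> {0}"
  then have "\<exists>s\<in>S. s \<noteq> 0" using separating_space_0[OF linear_D] by blast
  then obtain b where b: "b \<in> corner e" "\<exists>s\<in>S. b * s \<noteq> 0" and dich:
    "\<forall>c\<in>corner e. (\<forall>s\<in>S. b * c * s = 0) \<or> (\<forall>s\<in>S. b * s \<in> closure ((\<lambda>s. b * c * s) ` S))"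
    by (rule stability)
  obtain s0 where s0: "s0 \<in> S" "b * s0 \<noteq> 0" using b by blast
  have "b * s0 \<in> corner e" using b s0 S_corner corner_mult by blast
  then obtain b' where b': "b' \<in> corner e" "\<not> (\<exists>u\<in>corner e. (e - b' * (b * s0)) * u = e)"
    using semisimple s0(2) by blast
  define s1 where "s1 = b' * s0"
  have s1: "s1 \<in> S" unfolding s1_def using S_ideal b' s0 by blast
  define q where "q = b * s1"
  have q_eq: "b' * (b * s0) = q" by (simp add: q_def s1_def left_comm[OF b'(1) b(1)])
  have qB: "q \<in> corner e" using b s1 S_corner corner_mult by (auto simp: q_def)
  have approx: "\<exists>s\<in>S. norm (q - b * c * s) < 1"
    if c: "c \<in> corner e" "\<not> (\<forall>s\<in>S. b * c * s = 0)" for c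
  proof -
    have "q \<in> closure ((\<lambda>s. b * c * s) ` S)" using dich c s1 by (auto simp: q_def)
    then show ?thesis unfolding closure_approachable
      by (metis (no_types, lifting) dist_commute dist_norm image_iff zero_less_one)
  qed
  \<comment> \<open>Otherwise density puts some \<open>(e - q) * (b * s2)\<close> within distance
    \<open>1\<close> of \<open>q\<close>; then \<open>(e - q) * (e + b * s2)\<close> is invertible
    by Neumann's series, and so is \<open>e - q\<close>.\<close>
  have ann: "b * (e - q) * s = 0" if s: "s \<in> S" for s
  proof (rule ccontr)
    assume "b * (e - q) * s \<noteq> 0"
    then obtain s2 where s2: "s2 \<in> S" "norm (q - b * (e - q) * s2) < 1"
      using approx[of "e - q"] s corner_diff[OF e_corner qB] by blast
    define y where "y = q - b * (e - q) * s2"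
    have y: "y \<in> corner e" unfolding y_def
      using b qB S_corner[OF s2(1)] by (intro corner_diff corner_mult e_corner)
    obtain u where u: "u \<in> corner e" "(e - y) * u = e"
      using neumann_norm_less_1[OF e_idem y] s2 by (auto simp: y_def)
    have "(e - q) * (b * s2) = b * (e - q) * s2"
      by (simp add: left_comm[OF corner_diff[OF e_corner qB] b(1)] mult.assoc)
    then have "(e - q) * (e + b * s2) = e - y"
      by (simp add: distrib_left right_id y_def)
    then have "(e - q) * ((e + b * s2) * u) = e" using u by (simp flip: mult.assoc)
    moreover have "(e + b * s2) * u \<in> corner e"
      using b s2 u S_corner by (intro corner_mult corner_add e_corner) auto
    ultimately show False using b'(2) by (auto simp: q_eq)
  qed
  have qb: "q * (b * s) = b * s" if "s \<in> S" for s
  proof -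
    have "b * s - b * (q * s) = 0"
      using ann[OF that] by (simp add: right_diff_distrib left_diff_distrib right_id mult.assoc)
    then show ?thesis unfolding left_comm[OF qB b(1)] by simp
  qed
  have q: "q * q = q" using qb[OF s1] unfolding q_def[symmetric] .
  have q0: "q \<noteq> 0" using b'(2) e_corner e_idem by (auto simp: q_eq)
  have corner_q: "v \<in> corner q \<longleftrightarrow> v \<in> corner e \<and> q * v = v" for v
    using comm[OF _ qB, of v] cornerD(1)[OF qB] right_id[of v] unfolding corner_def
    by (auto, metis mult.assoc)
  \<comment> \<open>If \<open>a * q\<close> is no multiple of \<open>q\<close>, then every
    \<open>c = a - \<mu> e\<close> has \<open>c * q \<noteq> 0\<close>, so \<open>b * c * S\<close>
    is dense in \<open>b * S\<close> and \<open>c * q\<close> is invertible in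
    \<open>corner q\<close>, against Gelfand-Mazur.\<close>
  have scal: "\<exists>\<mu>. a * q = scaleC \<mu> q" if a: "a \<in> corner e" for a
  proof (rule ccontr)
    assume non: "\<not> ?thesis"
    have "\<exists>u\<in>corner q. (a * q - scaleC \<mu> q) * u = q \<and> u * (a * q - scaleC \<mu> q) = q" for \<mu>
    proof -
      define c where "c = a - scaleC \<mu> e"
      have c: "c \<in> corner e" unfolding c_def by (intro corner_diff a corner_scaleC e_corner)
      have cq: "c * q = a * q - scaleC \<mu> q"
        by (simp add: c_def left_diff_distrib mult_scaleC_left cornerD(1)[OF qB])
      have "b * c * s1 = c * q" by (simp add: q_def mult.assoc left_comm[OF b(1) c])
      then have "b * c * s1 \<noteq> 0" using non cq by auto
      then obtain s2 where s2: "s2 \<in> S" "norm (q - b * c * s2) < 1" using approx[OF c] s1 by blast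
      define v where "v = b * s2"
      have vB: "v \<in> corner e" unfolding v_def using b s2 S_corner corner_mult by blast
      have v: "q * v = v" using qb s2 by (simp add: v_def)
      have cv: "b * c * s2 = c * v" by (simp add: v_def mult.assoc left_comm[OF b(1) c])
      have y: "q - c * v \<in> corner q"
        unfolding corner_q using vB c qB
        by (auto intro!: corner_diff corner_mult simp: right_diff_distrib left_comm[OF qB c] v q)
      obtain u where u: "u \<in> corner q" "(q - (q - c * v)) * u = q"
        using neumann_norm_less_1[OF q y] s2(2) unfolding cv by blast
      have uB: "u \<in> corner e" using u corner_q by blast
      have "c * q * (v * u) = c * (q * v) * u" by (simp only: mult.assoc)
      then have 1: "c * q * (v * u) = q" using u v by simp
      moreover have "v * u * (c * q) = q"
        using 1 comm[of "c * q" "v * u"] c qB vB uB corner_mult by metis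
      moreover have "v * u \<in> corner q"
        unfolding corner_q using vB uB v by (simp add: corner_mult mult.assoc[symmetric])
      ultimately show ?thesis unfolding cq by blast
    qed
    moreover have "a * q \<in> corner q"
      unfolding corner_q using a qB by (simp add: corner_mult left_comm[OF qB a] q)
    ultimately show False using gelfand_mazur[OF q] q0 by blast
  qed
  \<comment> \<open>Derivations of commutative algebras kill idempotents: multiplying this identity
    by \<open>q\<close> gives \<open>q * D q = 0\<close>.\<close>
  have Dq: "D q = q * D q + q * D q"
    using D_mult[OF qB, of q] unfolding q comm[OF D_corner qB] .
  have "q * D q = q * (q * D q + q * D q)" using arg_cong[OF Dq, of "(*) q"] .
  also have "\<dots> = q * D q + q * D q" by (simp add: distrib_left mult.assoc[symmetric] q)
  finally have "q * D q = 0" unfolding add_cancel_right_right .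
  then have Dq0: "D q = 0" using Dq by (metis add_0)
  have qD: "q * D x = 0" for x
  proof -
    have qx: "q * x \<in> corner e" by (rule corner_left_ideal[OF qB])
    obtain \<mu> where "q * x * q = scaleC \<mu> q" using scal[OF qx] by blast
    moreover have "q * x * q = q * x" using comm[OF qx qB] by (simp add: mult.assoc[symmetric] q)
    ultimately have "D (q * x) = 0" by (simp add: D_scaleC Dq0)
    then show ?thesis using D_mult[OF qB, of x] Dq0 by simp
  qed
  have "q \<in> S" unfolding q_def using S_ideal b s1 by blast
  then obtain x where x: "norm (D x - q) < 1/2" using separating_spaceD[of q D "1/2"] by auto
  have "- q = q * (D x - q)" by (simp add: right_diff_distrib qD q)
  then have "norm q \<le> norm q * norm (D x - q)" by (metis norm_minus_cancel norm_mult_ineq)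
  also have "\<dots> \<le> norm q * (1/2)" using x by (intro mult_left_mono) auto
  finally show False using q0 by simp
qed

text \<open>The \<open>m\<close>-fold commutator of \<open>D ^ n\<close> with multiplication by \<open>a\<close>.\<close>

primrec iterated_commutator :: "'a \<Rightarrow> nat \<Rightarrow> nat \<Rightarrow> 'a \<Rightarrow> 'a" where
  "iterated_commutator a 0 n z = (D ^^ n) z"
| "iterated_commutator a (Suc m) n z =
     iterated_commutator a m n (a * z) - a * iterated_commutator a m n z"

text \<open>Taking commutators with multiplication by \<open>a\<close> is a derivation on operators;
  it sends \<open>D\<close> to multiplication by \<open>D a\<close> and, by commutativity, kills the
  latter. This is its Leibniz rule for \<open>D\<close> composed with \<open>D ^ n\<close>. At
  \<open>m = 0\<close> the truncated \<open>m - 1\<close> has coefficient \<open>0\<close>.\<close>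

lemma iterated_commutator_Suc:
  assumes a: "a \<in> corner e" and "z \<in> corner e"
  shows "iterated_commutator a m (Suc n) z =
    D (iterated_commutator a m n z) + real m *\<^sub>R (D a * iterated_commutator a (m - 1) n z)"
  using assms(2)
proof (induction m arbitrary: z)
  case (Suc m)
  let ?F = "\<lambda>m z. iterated_commutator a m n z" and ?h = "D a"
  have az: "a * z \<in> corner e" using a Suc.prems by (rule corner_mult)
  have D_eq: "D (?F (Suc m) z) = D (?F m (a * z)) - ?h * ?F m z - a * D (?F m z)"
    by (simp add: D_diff D_mult[OF a])
  have F_eq: "real m *\<^sub>R (?h * ?F (m - 1) (a * z)) - real m *\<^sub>R (a * (?h * ?F (m - 1) z)) = real m *\<^sub>R (?h * ?F m z)"
  proof (cases m)
    case (Suc k)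
    then show ?thesis
      by (simp add: left_comm[OF a D_corner] scaleR_diff_right[symmetric] right_diff_distrib[symmetric])
  qed simp
  have "iterated_commutator a (Suc m) (Suc n) z = D (?F m (a * z)) - a * D (?F m z) +
      (real m *\<^sub>R (?h * ?F (m - 1) (a * z)) - real m *\<^sub>R (a * (?h * ?F (m - 1) z)))"
    by (simp only: iterated_commutator.simps(2) Suc.IH[OF az] Suc.IH[OF Suc.prems])
       (simp add: distrib_left)
  also have "\<dots> = D (?F (Suc m) z) + real (Suc m) *\<^sub>R (?h * ?F m z)"
    unfolding F_eq D_eq by (simp add: algebra_simps)
  finally show ?case by simp
qed simp

text \<open>Each commutator lowers the degree in \<open>D\<close> by one.\<close>

lemma iterated_commutator_eq_0:
  assumes a: "a \<in> corner e" and z: "z \<in> corner e" and "m > n"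
  shows "iterated_commutator a m n z = 0"
  using \<open>m > n\<close>
proof (induction n arbitrary: m)
  case 0
  have "iterated_commutator a (Suc k) 0 z = 0" for k z
    by (induction k arbitrary: z) auto
  then show ?case using 0 gr0_implies_Suc by blast
next
  case (Suc n)
  then show ?case using iterated_commutator_Suc[OF a z, of m n] linear_0[OF linear_D] by simp
qed

text \<open>In the recursion the term under \<open>D\<close> has one commutator too many and
  vanishes; the coefficients \<open>Suc n\<close> build the factorial. Here \<open>upow\<close>
  starts from \<open>z\<close>, giving \<open>(D a) ^ n * z\<close>.\<close>

lemma iterated_commutator_fact:
  assumes a: "a \<in> corner e" and z: "z \<in> corner e"
  shows "iterated_commutator a n n z = fact n *\<^sub>R upow z (D a) n"
proof (induction n)
  case (Suc n)
  then show ?case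
    using iterated_commutator_Suc[OF a z, of "Suc n" n] iterated_commutator_eq_0[OF a z, of n "Suc n"]
    by (simp add: linear_0[OF linear_D] upow_Suc)
qed simp

lemma norm_iterated_commutator_le:
  assumes M: "M \<ge> 0" "\<And>y. norm (D y) \<le> M * norm y"
  shows "norm (iterated_commutator a m n z) \<le> (2 * norm a) ^ m * M ^ n * norm z"
proof (induction m arbitrary: z)
  case 0
  have "norm ((D ^^ n) z) \<le> M ^ n * norm z"
  proof (induction n)
    case (Suc n)
    have "norm ((D ^^ Suc n) z) \<le> M * norm ((D ^^ n) z)" using M by simp
    also have "\<dots> \<le> M * (M ^ n * norm z)" using M Suc by (intro mult_left_mono)
    finally show ?case by (simp add: mult_ac)
  qed simp
  then show ?case by simp
next
  case (Suc m)
  let ?K = "(2 * norm a) ^ m * M ^ n"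
  have "norm (iterated_commutator a m n (a * z)) \<le> ?K * norm (a * z)" by (rule Suc)
  also have "\<dots> \<le> ?K * (norm a * norm z)" using M by (intro mult_left_mono norm_mult_ineq) auto
  finally have 1: "norm (iterated_commutator a m n (a * z)) \<le> ?K * (norm a * norm z)" .
  have "norm (a * iterated_commutator a m n z) \<le> norm a * norm (iterated_commutator a m n z)"
    by (rule norm_mult_ineq)
  also have "\<dots> \<le> norm a * (?K * norm z)" by (intro mult_left_mono Suc) auto
  finally have 2: "norm (a * iterated_commutator a m n z) \<le> norm a * (?K * norm z)" .
  show ?case
    using 1 2 norm_triangle_ineq4[of "iterated_commutator a m n (a * z)" "a * iterated_commutator a m n z"]
    by (simp add: algebra_simps)
qed

text \<open>Kleinecke-Shirokov argument: the commutator bound makes the \<open>n\<close>-th power of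
  \<open>D a\<close> at most a geometric sequence over \<open>n!\<close>, so the Neumann series of
  every multiple \<open>b * D a\<close> converges.\<close>

lemma D_corner_eq_0:
  assumes a: "a \<in> corner e"
  shows "D a = 0"
proof (rule semisimple[OF D_corner])
  fix b assume b: "b \<in> corner e"
  obtain M where M: "M \<ge> 0" "\<And>y. norm (D y) \<le> M * norm y"
    using dist_separating_space_bounded[OF linear_D] S_trivial by auto
  define K where "K = norm b * (2 * norm a * M)"
  have bd: "norm (upow e (b * D a) n) \<le> (norm e * norm e) * (K ^ n / fact n)" for n
  proof -
    have "upow e (b * D a) n = upow e b n * upow e (D a) n"
    proof (induction n)
      case (Suc n)
      then show ?case
        by (simp add: upow_Suc mult.assoc left_comm[OF D_corner upow_corner[OF e_idem b]])
    qed (simp add: e_idem)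
    then have 1: "norm (upow e (b * D a) n) \<le> norm (upow e b n) * norm (upow e (D a) n)"
      by (simp add: norm_mult_ineq)
    have "fact n * norm (upow e (D a) n) \<le> (2 * norm a) ^ n * M ^ n * norm e"
      using norm_iterated_commutator_le[OF M, of a n n e] by (simp add: iterated_commutator_fact[OF a e_corner])
    then have 2: "norm (upow e (D a) n) \<le> (2 * norm a * M) ^ n * norm e / fact n"
      by (simp add: pos_le_divide_eq power_mult_distrib mult_ac)
    have "norm (upow e b n) * norm (upow e (D a) n)
        \<le> (norm e * norm b ^ n) * ((2 * norm a * M) ^ n * norm e / fact n)"
      using norm_upow_le 2 by (intro mult_mono) auto
    also have "\<dots> = (norm e * norm e) * (K ^ n / fact n)"
      by (simp add: K_def power_mult_distrib)
    finally show ?thesis using 1 by linarith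
  qed
  have sm: "summable (\<lambda>n. (norm e * norm e) * (K ^ n / fact n))"
    using summable_exp[of K] by (intro summable_mult) (simp add: field_simps)
  have "summable (\<lambda>n. norm (upow e (b * D a) n))"
    by (rule summable_comparison_test'[OF sm, of 0]) (simp only: real_norm_def abs_norm_cancel bd)
  then show "\<exists>u\<in>corner e. (e - b * D a) * u = e"
    using neumann_series[OF e_idem corner_mult[OF b D_corner]] by metis
qed

theorem D_eq_0: "D x = 0"
proof -
  have "e * x \<in> corner e" by (rule corner_left_ideal[OF e_corner])
  then have "D (e * x) = 0" by (rule D_corner_eq_0)
  then show ?thesis
    using D_mult[OF e_corner, of x] D_corner_eq_0[OF e_corner] cornerD(1)[OF D_corner] by simp
qed

end

section \<open>Skew centralizing generalized derivations\<close>

lemma apow_idem: "e * e = e \<Longrightarrow> apow e k = e"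
  by (induction e k rule: apow.induct) auto

lemma continuous_on_apow: "continuous_on UNIV (\<lambda>x::'a::real_normed_algebra. apow x k)"
proof (induction k)
  case (Suc k)
  then show ?case by (cases k) (auto intro!: continuous_intros)
qed (simp add: continuous_on_id)

text \<open>Modulo its right annihilator, the algebra is its corner \<open>e A\<close>, and the right annihilator
  consists of square-zero elements, so that quasi-invertibility may be tested in the corner.\<close>

lemma quasi_invertible_if_corner_invertible:
  fixes e y :: "'a::ring"
  assumes e: "\<And>a. a * e = a" and comm: "\<And>x y. x \<in> corner e \<Longrightarrow> y \<in> corner e \<Longrightarrow> x * y = y * x"
    and u: "u \<in> corner e" "(e - e * y) * u = e"
  shows "quasi_invertible y"
proof -
  define j c r where "j = e * y" and "c = e - u" and "r = y - j"
  have j: "j \<in> corner e" by (simp add: j_def corner_def e mult.assoc[symmetric])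
  have c: "c \<in> corner e" unfolding c_def by (intro corner_diff u) (simp add: corner_def e)
  have jc: "j + c - j * c = 0"
    using u e[of j] cornerD(1)[OF u(1)] by (simp add: c_def j_def[symmetric] algebra_simps)
  have r: "a * r = 0" for a by (simp add: r_def j_def right_diff_distrib mult.assoc[symmetric] e)
  have r': "a * (r * b) = 0" for a b by (simp add: mult.assoc[symmetric] r)
  \<comment> \<open>\<open>c\<close> is the quasi-inverse of \<open>j\<close> in the corner; as
    every product with \<open>r\<close> on the right vanishes, \<open>r * c - r\<close> is the
    correction for \<open>y = j + r\<close>.\<close>
  define b where "b = c + (r * c - r)"
  have y: "y = j + r" by (simp add: r_def)
  have "y + b - y * b = j + c - j * c"
    by (simp add: y b_def algebra_simps r r')
  moreover have "y + b - b * y = (j + c - j * c) + r * (j + c - j * c)"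
    using comm[OF j c] by (simp add: y b_def algebra_simps r r')
  ultimately show ?thesis unfolding quasi_invertible_def by (intro exI[of _ b]) (simp only: jc, simp)
qed

theorem theorem5p1:
  fixes \<delta> d :: "'a::cbanach_algebra \<Rightarrow> 'a" and k :: nat
  assumes rad_rann: "(jacobson_rad :: 'a set) = right_annihilator"
    and quot_comm: "\<forall>a b::'a. a * b - b * a \<in> jacobson_rad"
    and right_id: "\<exists>e::'a. \<forall>a. a * e = a"
    and gd: "is_gen_derivation \<delta> d"
    and k: "k \<ge> 1"
  shows "(k_skew_centralizing k \<delta> \<longrightarrow> (\<exists>z \<in> center. \<delta> = (\<lambda>a. a * z)))
       \<and> (k_skew_commuting k \<delta> \<longrightarrow> \<delta> = (\<lambda>_. 0))"
proof -
  obtain e :: 'a where e: "\<And>a. a * e = a" using right_id by blast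
  have comm3: "c * (a * b) = c * (b * a)" for a b c :: 'a
    using quot_comm by (simp add: rad_rann right_annihilator_def right_diff_distrib)
  have comm: "x * y = y * x" if "x \<in> corner e" "y \<in> corner e" for x y
    using comm3[of e x y] that by (simp add: corner_def mult.assoc[symmetric])
  have d_add: "d (x + y) = d x + d y" and d_scaleC: "d (scaleC c x) = scaleC c (d x)"
    and d_mult: "d (x * y) = d x * y + x * d y" and \<delta>_mult: "\<delta> (x * y) = x * \<delta> y + d x * y" for x y c
    using gd by (auto simp: is_gen_derivation_def is_derivation_def clinear_map_def)
  interpret corner_derivation e "\<lambda>x. e * d x"
  proof
    fix b x :: 'a assume "b \<in> corner e"
    then show "e * d (b * x) = e * d b * x + b * (e * d x)"
      by (simp add: d_mult distrib_left mult.assoc[symmetric] e cornerD)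
  next
    fix x assume x: "x \<in> corner e"
      and inv: "\<And>b. b \<in> corner e \<Longrightarrow> \<exists>u\<in>corner e. (e - b * x) * u = e"
    have "quasi_invertible (b * x)" for b
    proof -
      have "e * b \<in> corner e" by (simp add: corner_def e mult.assoc[symmetric])
      from inv[OF this] obtain u where "u \<in> corner e" "(e - e * (b * x)) * u = e"
        by (auto simp: mult.assoc)
      then show ?thesis by (intro quasi_invertible_if_corner_invertible[of e u] e comm)
    qed
    then have "x \<in> right_annihilator" by (simp add: jacobson_rad_def flip: rad_rann)
    then have "e * x = 0" by (simp add: right_annihilator_def)
    then show "x = 0" using cornerD(1)[OF x] by simp
  next
    show "clinear_map (\<lambda>x. e * d x)"
      by (simp add: clinear_map_def d_add d_scaleC distrib_left mult_scaleC_right)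
  next
    show "e * d x \<in> corner e" for x by (simp add: corner_def mult.assoc[symmetric] e)
  qed (fact e comm)+
  have ad: "a * d b = 0" for a b
  proof -
    have "a * d b = a * (e * d b)" by (simp add: e flip: mult.assoc)
    then show ?thesis by (simp only: D_eq_0 mult_zero_right)
  qed
  \<comment> \<open>Right multiplication by \<open>e * \<delta> e\<close> agrees with that by
    \<open>\<delta> e\<close>, and \<open>e\<close> fixes it from the left.\<close>
  define z where "z = e * \<delta> e"
  have \<delta>: "\<delta> a = a * z + d a" for a
    using \<delta>_mult[of a e] by (simp add: z_def e mult.assoc[symmetric])
  have ez: "e * z = z" by (simp add: z_def e_idem mult.assoc[symmetric])
  have ek: "apow e k = e" by (rule apow_idem[OF e_idem])
  have main: "z \<in> center \<and> \<delta> = (\<lambda>a. a * z)" if cent: "k_skew_centralizing k \<delta>"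
  proof -
    have cen: "skew_prod (\<delta> a) (apow a k) \<in> center" for a
      using cent by (simp add: k_skew_centralizing_def)
    \<comment> \<open>At \<open>a = e\<close> the skew product is \<open>2 z + d e\<close>;
      commuting with \<open>e\<close> kills \<open>d e\<close>, and then \<open>2 z\<close> is
      central.\<close>
    have de: "d e = 0" and zc: "z \<in> center"
    proof -
      have sk: "skew_prod (\<delta> e) (apow e k) = z + d e + z"
        by (simp add: skew_prod_def \<delta> ek e ez distrib_left ad)
      have comm_a: "(z + d e + z) * a = a * (z + d e + z)" for a
        using cen[of e] unfolding sk by (simp add: center_def)
      have "z + d e + z = z + z"
        using comm_a[of e] by (simp add: e distrib_left ez ad)
      then show de: "d e = 0" by simp
      show "z \<in> center"
      proof -
        have "2 *\<^sub>R (z * a) = 2 *\<^sub>R (a * z)" for a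
          using comm_a[of a] by (simp add: de distrib_left distrib_right scaleR_2)
        then show ?thesis by (simp add: center_def)
      qed
    qed
    have zcomm: "a * z = z * a" for a using zc by (simp add: center_def)
    have dp: "d a * apow a k = 0" for a
    proof -
      let ?p = "apow a k"
      have "skew_prod (\<delta> a) ?p * e = e * skew_prod (\<delta> a) ?p"
        using cen[of a] unfolding center_def by blast
      moreover have "skew_prod (\<delta> a) ?p = z * (a * ?p) + d a * ?p + z * (?p * a)"
        by (simp add: skew_prod_def \<delta> distrib_left distrib_right ad zcomm mult.assoc[symmetric])
      ultimately have "z * (a * ?p) + d a * ?p + z * (?p * a) = e * (z * (a * ?p) + d a * ?p + z * (?p * a))"
        by (simp only: e)
      also have "\<dots> = z * (a * ?p) + z * (?p * a)"
        by (simp add: distrib_left ez ad mult.assoc[symmetric])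
      finally show ?thesis by simp
    qed
    have "d a = 0" for a
    proof -
      define t where "t n = inverse (real (Suc n))" for n
      have t: "t \<longlonglongrightarrow> 0" unfolding t_def by (rule LIMSEQ_inverse_real_of_nat)
      \<comment> \<open>\<open>d (e + t a) = t d a\<close> because \<open>d e = 0\<close>;
        cancelling \<open>t\<close> in \<open>dp\<close> leaves
        \<open>d a * (e + t a) ^ k = 0\<close>, and the limit is
        \<open>d a * e = d a\<close>.\<close>
      have "(\<lambda>n. d a * apow (e + t n *\<^sub>R a) k) \<longlonglongrightarrow> d a * apow (e + 0 *\<^sub>R a) k"
        by (intro tendsto_intros continuous_on_tendsto_compose[OF continuous_on_apow] t) auto
      moreover have "d a * apow (e + t n *\<^sub>R a) k = 0" for n
      proof -
        have "d (t n *\<^sub>R a) = t n *\<^sub>R d a" by (simp add: d_scaleC flip: scaleC_of_real)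
        then show ?thesis using dp[of "e + t n *\<^sub>R a"] by (simp add: d_add de t_def)
      qed
      ultimately show ?thesis by (simp add: LIMSEQ_const_iff ek e)
    qed
    then show ?thesis using zc \<delta> by auto
  qed
  moreover have "\<delta> = (\<lambda>_. 0)" if com: "k_skew_commuting k \<delta>"
  proof -
    have "k_skew_centralizing k \<delta>"
      using com by (simp add: k_skew_commuting_def k_skew_centralizing_def center_def)
    then have zc: "z \<in> center" and \<delta>z: "\<delta> = (\<lambda>a. a * z)" using main by auto
    have "skew_prod (\<delta> e) (apow e k) = 0" using com by (simp add: k_skew_commuting_def)
    then have "2 *\<^sub>R z = 0" by (simp add: skew_prod_def ek \<delta>z ez e scaleR_2)
    then show ?thesis using \<delta>z by simp
  qed
  ultimately show ?thesis by blast
qed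

end
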